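(* Let $R$ be a noetherian integral domain (commutative), let $\mathcal{P}\subseteq R$ be any set all of whose elements are prime elements of $R$, let $S$ be the submonoid of the multiplicative monoid of $R$ generated by $\mathcal{P}$, and let $T$ be a commutative ring that is an $R$-algebra and is a localization of $R$ at $S$. If $T$ is a unique factorization domain, then $R$ is a unique factorization domain.
   Context: The submonoid generated by $\mathcal{P}$ is the smallest subset of $R$ containing $1$ and $\mathcal{P}$ and closed under multiplication. That an $R$-algebra $T$ is a localization of $R$ at $S$ is meant in the abstract sense (Mathlib's IsLocalization): every element of $S$ maps to a unit of $T$; every element of $T$ has the form $\iota(a)\iota(s)^{-1}$ with $a\in R$, $s\in S$, where $\iota\colon R\to T$ is the structure map; and $\iota(a)=\iota(b)$ only if $ua=ub$ for some $u\in S$. *)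

theory Defs
  imports "HOL-Algebra.Algebra"
begin

definition submonoid_generated :: "('a, 'm) monoid_scheme \<Rightarrow> 'a set \<Rightarrow> 'a set"
  where "submonoid_generated G A = \<Inter> {H. submonoid H G \<and> A \<subseteq> H}"

lemma (in monoid) submonoid_generated_is_submonoid:
  assumes "A \<subseteq> carrier G"
  shows "submonoid (submonoid_generated G A) G"
proof
  have "submonoid (carrier G) G"
    by (simp add: submonoid_def)
  with assms show "submonoid_generated G A \<subseteq> carrier G"
    unfolding submonoid_generated_def by blast
next
  fix x y
  assume "x \<in> submonoid_generated G A" "y \<in> submonoid_generated G A"
  then show "x \<otimes> y \<in> submonoid_generated G A"
    unfolding submonoid_generated_def by (auto intro: submonoid.m_closed)
next
  show "\<one> \<in> submonoid_generated G A"
    unfolding submonoid_generated_def by (auto intro: submonoid.one_closed)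
qed

lemma submonoid_generated_incl: "A \<subseteq> submonoid_generated G A"
  unfolding submonoid_generated_def by blast

lemma submonoid_generated_minimal:
  "\<lbrakk>submonoid H G; A \<subseteq> H\<rbrakk> \<Longrightarrow> submonoid_generated G A \<subseteq> H"
  unfolding submonoid_generated_def by blast

text \<open>
  An algebra over a commutative ring \<open>R\<close> is a commutative ring \<open>T\<close> with a ring homomorphism
  \<open>\<iota>\<close> from \<open>R\<close> to \<open>T\<close>, the structure map; \<open>\<iota>\<close> is not assumed to be injective.
\<close>

locale localization = ring_hom_cring R T \<iota> + submonoid S R
  for R (structure) and S and T (structure) and \<iota> +
  assumes map_units: "s \<in> S \<Longrightarrow> \<iota> s \<in> Units T"
    and fraction_exists:
      "x \<in> carrier T \<Longrightarrow> \<exists>a\<in>carrier R. \<exists>s\<in>S. x = \<iota> a \<otimes>\<^bsub>T\<^esub> inv\<^bsub>T\<^esub> (\<iota> s)"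
    and exists_of_eq:
      "\<lbrakk>a \<in> carrier R; b \<in> carrier R; \<iota> a = \<iota> b\<rbrakk> \<Longrightarrow> \<exists>u\<in>S. u \<otimes>\<^bsub>R\<^esub> a = u \<otimes>\<^bsub>R\<^esub> b"

end

theory Submission
  imports Defs
begin

text \<open>
  In a noetherian domain every nonzero nonunit is a product of irreducibles, so unique factorization
  amounts to irreducible elements being prime (\<open>factorial_domainI_irreducible_prime\<close>). Let \<open>q\<close> be
  irreducible in \<open>R\<close>. If some \<open>p \<in> P\<close> divides \<open>q\<close>, then \<open>q\<close> is associated to the prime \<open>p\<close>.

  Otherwise primeness of \<open>q\<close> is transported through \<open>T\<close>. On the one hand, prime factors can be
  stripped one at a time off a multiplier \<open>s \<in> S\<close>: in \<open>s \<otimes> q = a \<otimes> b\<close> each prime dividing \<open>s\<close>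
  goes into \<open>a\<close> or into \<open>b\<close>, where it becomes a unit of \<open>T\<close>, and what remains is a factorization
  of \<open>q\<close> in \<open>R\<close> (\<open>irreducible_split_unit\<close>); hence a factorization of \<open>\<iota> q\<close> in \<open>T\<close> has a unit
  factor. On the other hand, the same stripping shows that \<open>q\<close> divides \<open>x\<close> as soon as it divides
  \<open>s \<otimes> x\<close> (\<open>divides_cancel_generated\<close>), so that divisibility by \<open>\<iota> q\<close> in \<open>T\<close> descends to
  divisibility by \<open>q\<close> in \<open>R\<close>. In particular \<open>\<iota> q\<close> is not a unit, so it is irreducible, and thus
  prime because \<open>T\<close> is factorial; by descent \<open>q\<close> is prime as well.
\<close>

section \<open>Induction over a generated submonoid\<close>

text \<open>
  Only one generator is split off at a time. The elements \<open>h\<close> whose left multiplication preserves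
  the property form a submonoid; minimality applies to it, whereas the elements with property
  \<open>Q\<close> need not be closed under multiplication.
\<close>

lemma (in monoid) submonoid_generated_induct [consumes 2, case_names one mult]:
  assumes "x \<in> submonoid_generated G A" and "A \<subseteq> carrier G"
    and one: "Q \<one>"
    and mult: "\<And>p s. \<lbrakk>p \<in> A; s \<in> submonoid_generated G A; Q s\<rbrakk> \<Longrightarrow> Q (p \<otimes> s)"
  shows "Q x"
proof -
  let ?S = "submonoid_generated G A"
  interpret S: submonoid ?S G
    using assms(2) by (rule submonoid_generated_is_submonoid)
  let ?H = "{h \<in> ?S. \<forall>s \<in> ?S. Q s \<longrightarrow> Q (h \<otimes> s)}"
  have "submonoid ?H G"
    by standard (auto simp: m_assoc)
  moreover have "A \<subseteq> ?H"
    using mult submonoid_generated_incl[of A G] by blast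
  ultimately have "x \<in> ?H"
    using submonoid_generated_minimal assms(1) by blast
  then have "Q (x \<otimes> \<one>)" and "x \<in> ?S"
    using one by auto
  then show ?thesis
    by simp
qed

section \<open>Primes and irreducibles in a domain\<close>

lemma (in noetherian_domain) factorial_domainI_irreducible_prime:
  assumes "\<And>q. \<lbrakk>q \<in> carrier R; ring_irreducible q\<rbrakk> \<Longrightarrow> ring_prime q"
  shows "factorial_domain R"
proof -
  interpret primeness_condition_monoid "mult_of R"
  proof (intro primeness_condition_monoid.intro primeness_condition_monoid_axioms.intro)
    show "comm_monoid_cancel (mult_of R)"
      by (rule mult_of.is_comm_monoid_cancel)
    show "prime (mult_of R) q" if "q \<in> carrier (mult_of R)" "irreducible (mult_of R) q" for q
      using assms[of q] ring_irreducibleI'[of q] ring_primeE(2)[of q] that by simp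
  qed
  have "factorial_monoid (mult_of R)"
    using factorization_property wfactors_unique by (intro mult_of.factorial_monoidI) auto
  then show ?thesis
    by (intro factorial_domain.intro domain_axioms)
qed

lemma (in domain) prime_divides_irreducible_imp_prime:
  assumes "p \<in> carrier R" "ring_prime p" "q \<in> carrier R" "ring_irreducible q" "p divides q"
  shows "ring_prime q"
proof -
  have "p \<notin> Units R"
    using ring_primeE(3)[OF assms(1,2)] by (auto elim: primeE)
  then have "p \<sim> q"
    using divides_irreducible_condition[OF ring_irreducibleE(2)[OF assms(3,4)] assms(1,5)] by blast
  then have "prime (mult_of R) q"
    using mult_of.prime_cong[OF ring_primeE(2)[OF assms(1,2)]] assoc_iff_assoc_mult[OF assms(1,3)]
      assms(1,3) ring_primeE(1)[OF assms(1,2)] ring_irreducibleE(1)[OF assms(3,4)]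
    by simp
  then show ?thesis
    using assms(3) ring_irreducibleE(1)[OF assms(3,4)] by (intro ring_primeI') auto
qed

text \<open>
  From \<open>p \<otimes> x = q \<otimes> c\<close> with \<open>p\<close> prime and not dividing \<open>q\<close>, the prime \<open>p\<close> divides \<open>c\<close> and can
  be cancelled.
\<close>

lemma (in domain) divides_cancel_generated:
  assumes "P \<subseteq> carrier R" and prime: "\<And>p. p \<in> P \<Longrightarrow> ring_prime p"
    and q: "q \<in> carrier R" and nodiv: "\<And>p. p \<in> P \<Longrightarrow> \<not> p divides q"
    and "s \<in> submonoid_generated R P" and "x \<in> carrier R" and "q divides s \<otimes> x"
  shows "q divides x"
proof -
  interpret S: submonoid "submonoid_generated R P" R
    using assms(1) by (rule submonoid_generated_is_submonoid)
  from assms(5) assms(1) have "q divides s \<otimes> x \<longrightarrow> q divides x"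
  proof (induction rule: submonoid_generated_induct)
    case one
    then show ?case using assms(6) by simp
  next
    case (mult p s)
    have p: "p \<in> carrier R" using mult(1) assms(1) by blast
    have sx: "s \<otimes> x \<in> carrier R" using mult(2) assms(6) by simp
    have "q divides s \<otimes> x" if "q divides (p \<otimes> s) \<otimes> x"
    proof -
      from that obtain c where c: "c \<in> carrier R" "p \<otimes> (s \<otimes> x) = q \<otimes> c"
        using p mult(2) assms(6) by (auto simp: m_assoc)
      have "p divides q \<otimes> c"
        using c(2) sx by (metis dividesI')
      then have "p divides c"
        using primeE[OF ring_primeE(3)[OF p prime[OF mult(1)]]] q c(1) nodiv[OF mult(1)] by blast
      then obtain d where d: "d \<in> carrier R" "c = p \<otimes> d"
        by blast
      have "p \<otimes> (s \<otimes> x) = p \<otimes> (q \<otimes> d)"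
        using c(2) d p q by (simp add: m_lcomm)
      then have "s \<otimes> x = q \<otimes> d"
        using p sx q d(1) m_lcancel[OF ring_primeE(1)[OF p prime[OF mult(1)]] p] by simp
      then show ?thesis
        using d(1) by blast
    qed
    then show ?case using mult(3) by blast
  qed
  then show ?thesis using assms(7) by blast
qed

section \<open>Localization at a monoid generated by primes\<close>

lemma (in ring_hom_cring) hom_Units:
  assumes "u \<in> Units R"
  shows "h u \<in> Units S"
proof -
  have "h u \<otimes>\<^bsub>S\<^esub> h (inv u) = \<one>\<^bsub>S\<^esub>"
    using hom_mult[of u "inv u"] R.Units_closed[OF assms] assms by simp
  then show ?thesis
    using S.unit_factor[of "h u" "h (inv u)"] R.Units_closed[OF assms] assms by simp
qed

lemma (in localization) inj_on_carrier:
  assumes "domain R" "domain T"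
  shows "inj_on \<iota> (carrier R)"
proof (rule inj_onI)
  interpret R: domain R by fact
  interpret T: domain T by fact
  fix a b assume ab: "a \<in> carrier R" "b \<in> carrier R" "\<iota> a = \<iota> b"
  obtain u where u: "u \<in> S" "u \<otimes> a = u \<otimes> b"
    using exists_of_eq[OF ab] by blast
  \<comment> \<open>The image of \<open>u\<close> is a unit of the nonzero ring \<open>T\<close>.\<close>
  have "u \<noteq> \<zero>"
    using map_units[OF u(1)] T.zero_not_one by (auto simp: Units_def)
  then show "a = b"
    using u ab R.m_lcancel by auto
qed

text \<open>Clearing the denominator of the cofactor.\<close>

lemma (in localization) divides_image_imp:
  assumes "q \<in> carrier R" "x \<in> carrier R" "\<iota> q divides\<^bsub>T\<^esub> \<iota> x"
  shows "\<exists>s\<in>S. q divides s \<otimes> x"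
proof -
  obtain y where y: "y \<in> carrier T" "\<iota> x = \<iota> q \<otimes>\<^bsub>T\<^esub> y"
    using assms(3) by blast
  obtain c s where c: "c \<in> carrier R" and s: "s \<in> S" and "y = \<iota> c \<otimes>\<^bsub>T\<^esub> inv\<^bsub>T\<^esub> \<iota> s"
    using fraction_exists[OF y(1)] by blast
  note s_unit = map_units[OF s]
  have "\<iota> (s \<otimes> x) = \<iota> s \<otimes>\<^bsub>T\<^esub> (\<iota> q \<otimes>\<^bsub>T\<^esub> (\<iota> c \<otimes>\<^bsub>T\<^esub> inv\<^bsub>T\<^esub> \<iota> s))"
    using s assms y \<open>y = _\<close> by simp
  also have "\<dots> = (\<iota> q \<otimes>\<^bsub>T\<^esub> \<iota> c) \<otimes>\<^bsub>T\<^esub> (\<iota> s \<otimes>\<^bsub>T\<^esub> inv\<^bsub>T\<^esub> \<iota> s)"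
    using s_unit assms(1) c s by (simp add: S.m_ac del: S.Units_r_inv)
  also have "\<dots> = \<iota> (q \<otimes> c)"
    using s_unit assms(1) c by simp
  finally obtain u where u: "u \<in> S" "u \<otimes> (s \<otimes> x) = u \<otimes> (q \<otimes> c)"
    using exists_of_eq[of "s \<otimes> x" "q \<otimes> c"] assms c s by auto
  have "(u \<otimes> s) \<otimes> x = q \<otimes> (u \<otimes> c)"
    using u assms c s by (simp add: R.m_assoc R.m_lcomm)
  then show ?thesis
    using u(1) s c by (intro bexI[of _ "u \<otimes> s"] dividesI[of "u \<otimes> c"]) auto
qed

text \<open>
  The factors \<open>a\<close> and \<open>b\<close> absorb the prime factors of \<open>s\<close>, which are invertible in \<open>T\<close>; after that
  one of them is a unit already in \<open>R\<close>.
\<close>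

lemma (in localization) irreducible_split_unit:
  assumes "domain R" and "P \<subseteq> carrier R" and prime: "\<And>p. p \<in> P \<Longrightarrow> ring_prime p"
    and S_eq: "S = submonoid_generated R P"
    and q: "q \<in> carrier R" "ring_irreducible q"
    and "s \<in> S" "a \<in> carrier R" "b \<in> carrier R" "s \<otimes> q = a \<otimes> b"
  shows "\<iota> a \<in> Units T \<or> \<iota> b \<in> Units T"
proof -
  interpret R: domain R by fact
  have split: "s \<otimes> q = a' \<otimes> b"
    if "p \<in> P" "s \<in> S" "a' \<in> carrier R" "b \<in> carrier R" "(p \<otimes> s) \<otimes> q = (p \<otimes> a') \<otimes> b"
    for p s a' b
  proof -
    have p: "p \<in> carrier R" using that(1) assms(2) by blast
    show ?thesis
      using that p q(1) R.m_lcancel[OF R.ring_primeE(1)[OF p prime[OF that(1)]] p]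
      by (simp add: R.m_assoc)
  qed
  from assms(7)[unfolded S_eq] assms(2)
  have "\<forall>a\<in>carrier R. \<forall>b\<in>carrier R. s \<otimes> q = a \<otimes> b \<longrightarrow> \<iota> a \<in> Units T \<or> \<iota> b \<in> Units T"
  proof (induction rule: R.submonoid_generated_induct)
    case one
    then show ?case
      using q R.ring_irreducibleE(5)[OF q] hom_Units by (metis R.l_one)
  next
    case (mult p s)
    have p: "p \<in> carrier R" using mult(1) assms(2) by blast
    have p_unit: "\<iota> p \<in> Units T"
      using map_units mult(1) S_eq submonoid_generated_incl[of P R] by blast
    have s: "s \<in> S" using mult(2) S_eq by simp
    show ?case
    proof (intro ballI impI)
      fix a b assume ab: "a \<in> carrier R" "b \<in> carrier R" "(p \<otimes> s) \<otimes> q = a \<otimes> b"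
      have "p divides a \<otimes> b"
        using p s q(1) by (intro dividesI[of "s \<otimes> q"]) (auto simp: ab(3)[symmetric] R.m_assoc)
      then consider "p divides a" | "p divides b"
        using primeE[OF R.ring_primeE(3)[OF p prime[OF mult(1)]]] ab by blast
      then show "\<iota> a \<in> Units T \<or> \<iota> b \<in> Units T"
      proof cases
        case 1
        then obtain a' where a': "a' \<in> carrier R" "a = p \<otimes> a'" by blast
        then have "s \<otimes> q = a' \<otimes> b"
          using split mult(1) s ab by blast
        then have "\<iota> a' \<in> Units T \<or> \<iota> b \<in> Units T"
          using mult(3) a'(1) ab(2) by blast
        then show ?thesis
          using p_unit p a' by auto
      next
        case 2
        then obtain b' where b': "b' \<in> carrier R" "b = p \<otimes> b'" by blast
        then have "s \<otimes> q = b' \<otimes> a"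
          using split[of p s b' a] mult(1) s ab p by (simp add: R.m_comm)
        then have "\<iota> a \<in> Units T \<or> \<iota> b' \<in> Units T"
          using mult(3) b'(1) ab(1) by (simp add: R.m_comm)
        then show ?thesis
          using p_unit p b' by auto
      qed
    qed
  qed
  then show ?thesis using assms by blast
qed

lemma (in localization) irreducible_image:
  assumes "domain R" "domain T" and P: "P \<subseteq> carrier R" "\<And>p. p \<in> P \<Longrightarrow> ring_prime p"
    and S_eq: "S = submonoid_generated R P"
    and q: "q \<in> carrier R" "ring_irreducible q" and nodiv: "\<And>p. p \<in> P \<Longrightarrow> \<not> p divides q"
  shows "ring_irreducible\<^bsub>T\<^esub> (\<iota> q)"
proof -
  interpret R: domain R by fact
  interpret T: domain T by fact
  note inj = inj_on_carrier[OF assms(1,2)]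
  note q_irr = R.ring_irreducibleE[OF q]
  show ?thesis
  proof (rule T.ring_irreducibleI)
    show "\<iota> q \<in> carrier T - {\<zero>\<^bsub>T\<^esub>}"
      using q(1) q_irr(1) inj_onD[OF inj, of q \<zero>] by auto
  next
    show "\<iota> q \<notin> Units T"
    proof
      assume "\<iota> q \<in> Units T"
      then have "\<iota> q divides\<^bsub>T\<^esub> \<iota> \<one>"
        by (simp add: S.unit_divides)
      then obtain s where "s \<in> S" "q divides s \<otimes> \<one>"
        using divides_image_imp q(1) by blast
      then have "q divides \<one>"
        using R.divides_cancel_generated[OF P q(1) nodiv] S_eq by blast
      then show False
        using R.divides_one q(1) q_irr(4) by blast
    qed
  next
    \<comment> \<open>Clearing denominators turns a factorization of \<open>\<iota> q\<close> into one of an \<open>S\<close>-multiple of \<open>q\<close>.\<close>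
    fix x y assume xy: "x \<in> carrier T" "y \<in> carrier T" "\<iota> q = x \<otimes>\<^bsub>T\<^esub> y"
    obtain a s where a: "a \<in> carrier R" and s: "s \<in> S" and x: "x = \<iota> a \<otimes>\<^bsub>T\<^esub> inv\<^bsub>T\<^esub> \<iota> s"
      using fraction_exists[OF xy(1)] by blast
    obtain b t where b: "b \<in> carrier R" and t: "t \<in> S" and y: "y = \<iota> b \<otimes>\<^bsub>T\<^esub> inv\<^bsub>T\<^esub> \<iota> t"
      using fraction_exists[OF xy(2)] by blast
    have st: "s \<in> carrier R" "t \<in> carrier R" using s t by auto
    note units = map_units[OF s] map_units[OF t]
    have "\<iota> a = x \<otimes>\<^bsub>T\<^esub> \<iota> s" "\<iota> b = y \<otimes>\<^bsub>T\<^esub> \<iota> t"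
      using units a b st by (simp_all add: x y S.m_assoc)
    then have "\<iota> ((s \<otimes> t) \<otimes> q) = \<iota> (a \<otimes> b)"
      using a b st q(1) xy by (simp add: S.m_ac)
    then have "(s \<otimes> t) \<otimes> q = a \<otimes> b"
      using inj_onD[OF inj] a b st q(1) by simp
    then have "\<iota> a \<in> Units T \<or> \<iota> b \<in> Units T"
      using irreducible_split_unit[OF assms(1) P S_eq q] s t a b by blast
    then show "x \<in> Units T \<or> y \<in> Units T"
      using units by (auto simp: x y)
  qed
qed

lemma (in localization) irreducible_imp_prime:
  assumes "domain R" "factorial_domain T" and P: "P \<subseteq> carrier R" "\<And>p. p \<in> P \<Longrightarrow> ring_prime p"
    and S_eq: "S = submonoid_generated R P"
    and q: "q \<in> carrier R" "ring_irreducible q"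
  shows "ring_prime q"
proof (cases "\<exists>p\<in>P. p divides q")
  interpret R: domain R by fact
  case True
  then show ?thesis
    using R.prime_divides_irreducible_imp_prime P q by blast
next
  interpret R: domain R by fact
  interpret T: factorial_domain T by fact
  case False
  then have nodiv: "\<not> p divides q" if "p \<in> P" for p
    using that by blast
  have \<iota>q: "\<iota> q \<in> carrier T" "ring_irreducible\<^bsub>T\<^esub> (\<iota> q)"
    using q irreducible_image[OF assms(1) T.domain_axioms P S_eq q nodiv] by auto
  then have "prime (mult_of T) (\<iota> q)"
    using T.ring_irreducibleE by (intro T.irreducible_prime) auto
  then have prime: "prime T (\<iota> q)"
    using T.prime_eq_prime_mult \<iota>q(1) by blast
  have descend: "q divides x" if "x \<in> carrier R" "\<iota> q divides\<^bsub>T\<^esub> \<iota> x" for x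
    using divides_image_imp[OF q(1) that] R.divides_cancel_generated[OF P q(1) nodiv _ that(1)] S_eq
    by blast
  have "prime R q"
  proof (rule primeI)
    show "q \<notin> Units R"
      using R.ring_irreducibleE(4)[OF q] .
  next
    fix a b assume ab: "a \<in> carrier R" "b \<in> carrier R" "q divides a \<otimes> b"
    then obtain c where "c \<in> carrier R" "a \<otimes> b = q \<otimes> c" by blast
    then have "\<iota> a \<otimes>\<^bsub>T\<^esub> \<iota> b = \<iota> q \<otimes>\<^bsub>T\<^esub> \<iota> c"
      using ab q(1) by (simp flip: hom_mult)
    then have "\<iota> q divides\<^bsub>T\<^esub> \<iota> a \<otimes>\<^bsub>T\<^esub> \<iota> b"
      using \<open>c \<in> carrier R\<close> by blast
    then have "\<iota> q divides\<^bsub>T\<^esub> \<iota> a \<or> \<iota> q divides\<^bsub>T\<^esub> \<iota> b"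
      using primeE[OF prime] ab by blast
    then show "q divides a \<or> q divides b"
      using descend ab by blast
  qed
  then show ?thesis
    using R.ring_primeI R.ring_irreducibleE(1)[OF q] by blast
qed

theorem mainTheorem4:
  fixes R :: "('a, 'm) ring_scheme" and T :: "('b, 'n) ring_scheme"
    and P S :: "'a set" and \<iota> :: "'a \<Rightarrow> 'b"
  assumes "noetherian_domain R"
    and "P \<subseteq> carrier R"
    and "\<And>p. p \<in> P \<Longrightarrow> ring_prime\<^bsub>R\<^esub> p"
    and "S = submonoid_generated R P"
    and "localization R S T \<iota>"
    and "factorial_domain T"
  shows "factorial_domain R"
proof -
  interpret R: noetherian_domain R by fact
  interpret localization R S T \<iota> by fact
  show ?thesis
    using irreducible_imp_prime[OF R.domain_axioms assms(6,2,3,4)]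
    by (intro R.factorial_domainI_irreducible_prime)
qed

end
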